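(* Let $a,b,c,d,e\in\mathbb{C}$ with $c\neq 0$ and $e\neq 0$, and let $T_n$ be the $n\times n$ pentadiagonal Toeplitz matrix with $a$ on the main diagonal, $b$ on the first and $c$ on the second superdiagonal, $d$ on the first and $e$ on the second subdiagonal, and zeros elsewhere. Let $$p(x)=x^4+\tfrac{b}{c}x^3+\tfrac{a}{c}x^2+\tfrac{d}{c}x+\tfrac{e}{c}.$$ Then for every integer $n\ge 4$ the following hold. (I) If $p(x)=(x-\lambda_1)(x-\lambda_2)(x-\lambda_3)(x-\lambda_4)$ with $\lambda_1,\lambda_2,\lambda_3,\lambda_4$ distinct, then $\det(T_n)=c^n\frac{E}{D}$, where $$\begin{aligned}E&=(\lambda_2-\lambda_3)(\lambda_1-\lambda_4)\left((\lambda_2\lambda_3)^{n+2}+(\lambda_1\lambda_4)^{n+2}\right)\\&\quad-(\lambda_1-\lambda_3)(\lambda_2-\lambda_4)\left((\lambda_1\lambda_3)^{n+2}+(\lambda_2\lambda_4)^{n+2}\right)\\&\quad+(\lambda_1-\lambda_2)(\lambda_3-\lambda_4)\left((\lambda_1\lambda_2)^{n+2}+(\lambda_3\lambda_4)^{n+2}\right),\\ D&=(\lambda_1-\lambda_2)(\lambda_1-\lambda_3)(\lambda_1-\lambda_4)(\lambda_2-\lambda_3)(\lambda_2-\lambda_4)(\lambda_3-\lambda_4).\end{aligned}$$ (II) If $p(x)=(x-\lambda_1)^2(x-\lambda_2)(x-\lambda_3)$ with $\lambda_1,\lambda_2,\lambda_3$ distinct, then $\det(T_n)=c^n\frac{E}{D}$,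 where $$\begin{aligned}E&=\lambda_1^{1+n}\Big(\lambda_1^{3+n}(\lambda_2-\lambda_3)+\lambda_2^{2+n}\big(\lambda_1(-(2+n)\lambda_1+\lambda_2+n\lambda_2)+((3+n)\lambda_1-(2+n)\lambda_2)\lambda_3\big)\Big)\\&\quad+\lambda_3^{2+n}\Big(\lambda_2^{2+n}(\lambda_2-\lambda_3)+\lambda_1^{1+n}\big((2+n)\lambda_1^2+(2+n)\lambda_2\lambda_3-\lambda_1((3+n)\lambda_2+\lambda_3+n\lambda_3)\big)\Big),\\ D&=(\lambda_1-\lambda_2)^2(\lambda_1-\lambda_3)^2(\lambda_2-\lambda_3).\end{aligned}$$ (III) If $p(x)=(x-\lambda_1)^2(x-\lambda_2)^2$ with $\lambda_1\ne\lambda_2$, then $\det(T_n)=c^n\frac{E}{D}$, where $$\begin{aligned}E&=\lambda_1^{4+2n}-(2+n)^2(\lambda_1\lambda_2)^{1+n}(\lambda_1^2+\lambda_2^2)+2(3+4n+n^2)(\lambda_1\lambda_2)^{2+n}+\lambda_2^{4+2n},\\ D&=(\lambda_1-\lambda_2)^4.\end{aligned}$$ (IV) If $p(x)=(x-\lambda_1)^3(x-\lambda_2)$ with $\lambda_1\ne\lambda_2$, then $\det(T_n)=c^n\frac{E}{D}$, where $$\begin{aligned}E&=(2+n)\lambda_1^n\Big((1+n)(\lambda_1^{3+n}-\lambda_2^{3+n})-(3+n)\lambda_1^{2+n}\lambda_2+(3+n)\lambda_1\lambda_2^{2+n}\Big),\\ D&=2(\lambda_1-\lambda_2)^3.\end{aligned}$$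 (V) If $p(x)=(x-\lambda_1)^4$, then $$\det(T_n)=\frac{c^n}{12}(n+3)(n+2)^2(n+1)\lambda_1^{2n}.$$
   Context: Explicitly, $(T_n)_{i,i}=a$, $(T_n)_{i,i+1}=b$, $(T_n)_{i,i+2}=c$, $(T_n)_{i+1,i}=d$, $(T_n)_{i+2,i}=e$ whenever the indices lie in $\{1,\dots,n\}$, and all other entries are $0$. *)

theory Defs
  imports Complex_Main "HOL-Computational_Algebra.Polynomial" "Jordan_Normal_Form.Determinant"
begin

(* Matrix indices run from 0 to n - 1; only the difference j - i of the column and
   row index matters, so this agrees with indexing by 1, ..., n. *)
definition penta_toeplitz ::
  "nat \<Rightarrow> complex \<Rightarrow> complex \<Rightarrow> complex \<Rightarrow> complex \<Rightarrow> complex \<Rightarrow> complex mat"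
where
  "penta_toeplitz n a b c d e = mat n n (\<lambda>(i, j).
     if j = i then a
     else if j = i + 1 then b
     else if j = i + 2 then c
     else if i = j + 1 then d
     else if i = j + 2 then e
     else 0)"

definition penta_poly ::
  "complex \<Rightarrow> complex \<Rightarrow> complex \<Rightarrow> complex \<Rightarrow> complex \<Rightarrow> complex poly"
where
  "penta_poly a b c d e = [:e / c, d / c, a / c, b / c, 1:]"

end

(* Let v be a solution of the recurrence with characteristic polynomial p such that
   v 0 = v 1 = v 2 = 0. Border T_n with two more columns and rows to the banded matrix A with unit
   rows at the bottom, and replace the first two columns of the identity by v and its shift,
   restricted to the indices 2, ..., n + 3. Multiplying A by the resulting lower triangular matrix
   clears the first two columns except in the bottom rows, so that
     v(3)^2 det T_n = c^n (v(n+3)^2 - v(n+2) v(n+4)).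
   In each case v is a combination of the sequences k^j l^k with l a root of p of multiplicity
   greater than j, scaled to clear denominators (the coefficients are those of the partial fraction
   expansion of 1/p), and a polynomial identity remains. *)
theory Submission
  imports Defs
begin

section \<open>Determinants of small and of block matrices\<close>

lemma det_2x2:
  fixes p q r s :: "'a :: comm_ring_1"
  shows "det (mat 2 2 (\<lambda>(i, j). if i = 0 then if j = 0 then p else q else if j = 0 then r else s)) = p * s - q * r"
  by (subst laplace_expansion_column[of _ 2 0])
    (auto simp: numeral_2_eq_2 cofactor_def mat_delete_def det_single)

text \<open>Moving the first \<open>m\<close> columns past the other \<open>n\<close> costs
  \<open>m * n\<close> sign changes and leaves a block lower triangular matrix.\<close>

lemma det_four_block_mat_upper_left_zero:
  fixes B :: "'a :: idom mat"
  assumes B: "B \<in> carrier_mat n n" and C: "C \<in> carrier_mat m m" and D: "D \<in> carrier_mat m n"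
  shows "det (four_block_mat (0\<^sub>m n m) B C D) = (-1) ^ (m * n) * (det B * det C)"
proof -
  let ?A = "four_block_mat (0\<^sub>m n m) B C D"
  have A: "?A \<in> carrier_mat (n + m) (n + m)" using B C D by auto
  have "det ?A = (-1) ^ (m * n) * det (mat (n + m) (n + m) (\<lambda>(i, j).
      ?A $$ (i, if j < n then j + m else if j < m + n then j - n else j)))"
    by (rule det_swap_initial_cols[OF A]) simp
  also have "mat (n + m) (n + m) (\<lambda>(i, j).
      ?A $$ (i, if j < n then j + m else if j < m + n then j - n else j)) = four_block_mat B (0\<^sub>m n m) D C"
    by (rule eq_matI) (use B C D in auto)
  also have "det \<dots> = det B * det C"
    by (rule det_four_block_mat_upper_right_zero[OF B refl D C])
  finally show ?thesis .
qed

section \<open>Rows of a pentadiagonal matrix applied to a sequence\<close>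

lemma sum_delta_shift:
  fixes g :: "nat \<Rightarrow> 'a :: comm_monoid_add"
  assumes "i < N"
  shows "(\<Sum>k<N. if i = k + m then g k else 0) = (if m \<le> i then g (i - m) else 0)"
proof (cases "m \<le> i")
  case True
  have "(\<Sum>k<N. if i = k + m then g k else 0) = (\<Sum>k<N. if k = i - m then g k else 0)"
    by (rule sum.cong) (use True in auto)
  also have "\<dots> = g (i - m)"
    using assms by (simp only: sum.delta finite_lessThan lessThan_iff less_imp_diff_less if_True)
  finally show ?thesis using True by simp
qed auto

text \<open>With \<open>n + 2\<close> columns, no row \<open>i < n\<close> loses a superdiagonal
  entry on the right. The subdiagonal entries missing on the left in rows 0 and 1 would multiply
  \<open>f 0\<close> or \<open>f 1\<close>, so their absence does not show.\<close>

lemma pentadiagonal_sum: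
  fixes f :: "nat \<Rightarrow> complex"
  assumes i: "i < n" and f: "f 0 = 0" "f 1 = 0"
  shows "(\<Sum>k<n + 2. (if k = i then a else if k = i + 1 then b else if k = i + 2 then c
           else if i = k + 1 then d else if i = k + 2 then e else 0) * f (k + 2))
         = e * f i + d * f (i + 1) + a * f (i + 2) + b * f (i + 3) + c * f (i + 4)"
    (is "(\<Sum>k<n + 2. ?t k) = _")
proof -
  have "(\<Sum>k<n + 2. ?t k) = (\<Sum>k<n + 2. (if i = k + 2 then e * f (k + 2) else 0)
      + (if i = k + 1 then d * f (k + 2) else 0) + (if k = i then a * f (k + 2) else 0)
      + (if k = i + 1 then b * f (k + 2) else 0) + (if k = i + 2 then c * f (k + 2) else 0))"
    by (rule sum.cong) simp_all
  also have "\<dots> = (if 2 \<le> i then e * f i else 0) + (if 1 \<le> i then d * f (i + 1) else 0)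
      + a * f (i + 2) + b * f (i + 3) + c * f (i + 4)"
    unfolding sum.distrib using i
    by (simp only: sum.delta finite_lessThan lessThan_iff sum_delta_shift trans_less_add1 add_less_mono1
        le_add_diff_inverse2 cong: if_cong) (simp add: numeral_eq_Suc)
  also have "(if 2 \<le> i then e * f i else 0) = e * f i"
    using f by (cases "i = 0"; cases "i = 1") auto
  also have "(if 1 \<le> i then d * f (i + 1) else 0) = d * f (i + 1)"
    using f by (cases "i = 0") auto
  finally show ?thesis .
qed

section \<open>The determinant in terms of a solution of the recurrence\<close>

lemma det_penta_toeplitz:
  fixes v :: "nat \<Rightarrow> complex"
  assumes rec: "\<And>k. e * v k + d * v (k + 1) + a * v (k + 2) + b * v (k + 3) + c * v (k + 4) = 0"
    and v: "v 0 = 0" "v 1 = 0" "v 2 = 0"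
  shows "v 3 ^ 2 * det (penta_toeplitz n a b c d e) = c ^ n * (v (n + 3) ^ 2 - v (n + 2) * v (n + 4))"
proof -
  define t where "t = (\<lambda>i j :: nat. if j = i then a else if j = i + 1 then b
    else if j = i + 2 then c else if i = j + 1 then d else if i = j + 2 then e else 0)"
  \<comment> \<open>The two extra columns restore the superdiagonal entries cut off in
    \<open>penta_toeplitz\<close>; the unit rows keep the determinant unchanged.\<close>
  define A where "A = mat (n + 2) (n + 2) (\<lambda>(i, j). if i < n then t i j else if i = j then 1 else 0)"
  \<comment> \<open>The shifted sequence comes first, so that both leading diagonal entries are
    \<open>v 3\<close> and the entry above them is \<open>v 2 = 0\<close>.\<close>
  define W where "W = mat (n + 2) (n + 2) (\<lambda>(k, j). if j = 0 then v (k + 3) else if j = 1 then v (k + 2)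
    else if k = j then 1 else 0)"
  \<comment> \<open>Without its first two columns the band is lower triangular, with the second
    superdiagonal \<open>c\<close> as its diagonal.\<close>
  define L where "L = mat n n (\<lambda>(i, j). t i (j + 2))"
  define U where "U = mat 2 2 (\<lambda>(i, j). if i = 0 then if j = 0 then v (n + 3) else v (n + 2)
    else if j = 0 then v (n + 4) else v (n + 3))"
  define X where "X = mat 2 n (\<lambda>(i, j). if i + n = j + 2 then (1::complex) else 0)"
  have A: "A \<in> carrier_mat (n + 2) (n + 2)" and W: "W \<in> carrier_mat (n + 2) (n + 2)"
    and L: "L \<in> carrier_mat n n" and U: "U \<in> carrier_mat 2 2" and X: "X \<in> carrier_mat 2 n"
    by (simp_all add: A_def W_def L_def U_def X_def)
  have "A = four_block_mat (penta_toeplitz n a b c d e) (mat n 2 (\<lambda>(i, j). t i (j + n))) (0\<^sub>m 2 n) (1\<^sub>m 2)"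
    by (rule eq_matI) (auto simp: A_def penta_toeplitz_def t_def)
  also have "det \<dots> = det (penta_toeplitz n a b c d e) * det (1\<^sub>m 2)"
    by (rule det_four_block_mat_lower_left_zero) (auto simp: penta_toeplitz_def)
  finally have detA: "det A = det (penta_toeplitz n a b c d e)" by simp
  have "det W = prod_list (diag_mat W)"
    by (rule det_lower_triangular[OF _ W]) (use v in \<open>auto simp: W_def numeral_2_eq_2\<close>)
  also have "diag_mat W = v 3 # v 3 # map (\<lambda>_. 1) [0..<n]"
    by (rule nth_equalityI) (auto simp: W_def diag_mat_def nth_Cons numeral_eq_Suc simp del: upt_Suc split: nat.splits)
  also have "prod_list \<dots> = v 3 ^ 2"
    by (simp add: power2_eq_square map_replicate_const)
  finally have detW: "det W = v 3 ^ 2" .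
  have "det L = prod_list (diag_mat L)"
    by (rule det_lower_triangular[OF _ L]) (auto simp: L_def t_def)
  also have "diag_mat L = replicate n c"
    by (rule nth_equalityI) (auto simp: L_def t_def diag_mat_def)
  finally have detL: "det L = c ^ n" by simp
  have detU: "det U = v (n + 3) ^ 2 - v (n + 2) * v (n + 4)"
    unfolding U_def by (simp add: det_2x2 power2_eq_square)
  have AW: "A * W = four_block_mat (0\<^sub>m n 2) L U X"
  proof (rule eq_matI)
    fix i j assume "i < dim_row (four_block_mat (0\<^sub>m n 2) L U X)" "j < dim_col (four_block_mat (0\<^sub>m n 2) L U X)"
    then have i: "i < n + 2" and j: "j < n + 2" using L U X by auto
    have entry: "(A * W) $$ (i, j) = (\<Sum>k<n + 2. A $$ (i, k) * W $$ (k, j))"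
      using i j A W by (simp add: scalar_prod_def atLeast0LessThan)
    show "(A * W) $$ (i, j) = four_block_mat (0\<^sub>m n 2) L U X $$ (i, j)"
    proof (cases "j < 2")
      case False
      \<comment> \<open>These columns of \<open>W\<close> are unit vectors, so the product keeps the
        columns of \<open>A\<close>: \<open>L\<close> above, \<open>X\<close> below.\<close>
      have "(A * W) $$ (i, j) = (\<Sum>k<n + 2. if k = j then A $$ (i, k) else 0)"
        unfolding entry using j False by (intro sum.cong) (auto simp: W_def)
      then have "(A * W) $$ (i, j) = A $$ (i, j)" using j by (simp only: sum.delta finite_lessThan lessThan_iff if_True)
      moreover obtain j' where "j = j' + 2" using False by (metis add.commute le_Suc_ex not_less)
      ultimately show ?thesis
        using i j L U X by (auto simp: A_def L_def X_def)
    next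
      case True
      show ?thesis
      proof (cases "i < n")
        case i': False
        \<comment> \<open>The last two rows of \<open>A\<close> are unit rows and copy the rows of
          \<open>W\<close>; this is where \<open>U\<close> comes from.\<close>
        have "(A * W) $$ (i, j) = (\<Sum>k<n + 2. if k = i then W $$ (k, j) else 0)"
          unfolding entry using i i' by (intro sum.cong) (auto simp: A_def)
        then have "(A * W) $$ (i, j) = W $$ (i, j)" using i by (simp only: sum.delta finite_lessThan lessThan_iff if_True)
        moreover have "i = n \<or> i = n + 1" "j = 0 \<or> j = 1" using i i' True by auto
        ultimately show ?thesis
          using i j True L U X by (auto simp: W_def U_def numeral_eq_Suc)
      next
        case i': True
        (* truncated subtraction: column 0 of W is the shift of v, column 1 is v itself *)
        have "(A * W) $$ (i, j) = (\<Sum>k<n + 2. t i k * v (k + 2 + (1 - j)))"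
          unfolding entry by (rule sum.cong) (use i' j True in \<open>auto simp: A_def W_def numeral_3_eq_3 less_2_cases_iff\<close>)
        also have "\<dots> = 0"
          using True[unfolded less_2_cases_iff]
        proof
          \<comment> \<open>The shifted sequence begins with \<open>v 1\<close> and
            \<open>v 2\<close>, and the recurrence is taken at \<open>i + 1\<close>.\<close>
          assume "j = 0"
          then show ?thesis
            unfolding t_def using pentadiagonal_sum[OF i', of "\<lambda>k. v (k + 1)" a b c d e] v rec[of "i + 1"]
            by (simp add: algebra_simps numeral_eq_Suc)
        next
          assume "j = Suc 0"
          then show ?thesis
            unfolding t_def using pentadiagonal_sum[OF i', of v a b c d e] v rec[of i]
            by simp
        qed
        finally show ?thesis using i' True L U X i j by simp
      qed
    qed
  qed (use A W L U X in auto)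
  have "det A * det W = det (A * W)" using det_mult[OF A W] by simp
  also have "\<dots> = (-1) ^ (2 * n) * (det L * det U)"
    unfolding AW by (rule det_four_block_mat_upper_left_zero[OF L U X])
  finally show ?thesis by (simp add: detA detW detL detU mult.commute)
qed

section \<open>From the coefficients to the roots\<close>

text \<open>Vieta's formulas, cleared of the denominator \<open>c\<close>. The first one also shows
  that no root vanishes when \<open>e \<noteq> 0\<close>.\<close>

lemma penta_poly_eq_prodD:
  assumes "penta_poly a b c d e = [:- l1, 1:] * [:- l2, 1:] * [:- l3, 1:] * [:- l4, 1:]" and "c \<noteq> 0"
  shows "e = c * (l1 * l2 * l3 * l4)"
    and "d = - c * (l1 * l2 * l3 + l1 * l2 * l4 + l1 * l3 * l4 + l2 * l3 * l4)"
    and "a = c * (l1 * l2 + l1 * l3 + l1 * l4 + l2 * l3 + l2 * l4 + l3 * l4)"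
    and "b = - c * (l1 + l2 + l3 + l4)"
  using assms by (auto simp: penta_poly_def field_simps)

text \<open>The roots may coincide, so all five cases can use this form. The last assumption is the
  claimed quotient cleared of denominators, which leaves a polynomial identity in each case;
  \<open>v 3 \<noteq> 0\<close> permits cancelling.\<close>

lemma det_penta_toeplitz_of_roots:
  fixes v :: "nat \<Rightarrow> complex"
  assumes p: "penta_poly a b c d e = [:- l1, 1:] * [:- l2, 1:] * [:- l3, 1:] * [:- l4, 1:]" and c: "c \<noteq> 0"
    and rec: "\<And>k. v (k + 4) - (l1 + l2 + l3 + l4) * v (k + 3)
      + (l1 * l2 + l1 * l3 + l1 * l4 + l2 * l3 + l2 * l4 + l3 * l4) * v (k + 2)
      - (l1 * l2 * l3 + l1 * l2 * l4 + l1 * l3 * l4 + l2 * l3 * l4) * v (k + 1)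
      + l1 * l2 * l3 * l4 * v k = 0"
    and v: "v 0 = 0" "v 1 = 0" "v 2 = 0" "v 3 \<noteq> 0"
    and D: "D \<noteq> 0"
    and E: "(v (n + 3) ^ 2 - v (n + 2) * v (n + 4)) * D = v 3 ^ 2 * E"
  shows "det (penta_toeplitz n a b c d e) = c ^ n * (E / D)"
proof -
  (* The qualified name is needed because HOL-Algebra has another method of the name algebra. *)
  have "e * v k + d * v (k + 1) + a * v (k + 2) + b * v (k + 3) + c * v (k + 4) = 0" for k
    unfolding penta_poly_eq_prodD[OF p c] using rec[of k] by Groebner_Basis.algebra
  then have "v 3 ^ 2 * det (penta_toeplitz n a b c d e) = c ^ n * (v (n + 3) ^ 2 - v (n + 2) * v (n + 4))"
    using v by (intro det_penta_toeplitz) auto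
  then have "v 3 ^ 2 * (det (penta_toeplitz n a b c d e) * D) = v 3 ^ 2 * (c ^ n * E)"
    using E by (simp only: mult.assoc[symmetric]) (simp only: mult.assoc mult.left_commute)
  then show ?thesis using v D by (simp add: field_simps)
qed

section \<open>The five patterns of root multiplicities\<close>

theorem mainTheorem2:
  fixes a b c d e :: complex and n :: nat
  assumes "c \<noteq> 0" and "e \<noteq> 0" and "n \<ge> 4"
  shows
    "(\<forall>l1 l2 l3 l4 :: complex.
        penta_poly a b c d e = [:- l1, 1:] * [:- l2, 1:] * [:- l3, 1:] * [:- l4, 1:] \<longrightarrow>
        distinct [l1, l2, l3, l4] \<longrightarrow>
        det (penta_toeplitz n a b c d e) =
          c ^ n *
          (((l2 - l3) * (l1 - l4) * ((l2 * l3) ^ (n + 2) + (l1 * l4) ^ (n + 2))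
            - (l1 - l3) * (l2 - l4) * ((l1 * l3) ^ (n + 2) + (l2 * l4) ^ (n + 2))
            + (l1 - l2) * (l3 - l4) * ((l1 * l2) ^ (n + 2) + (l3 * l4) ^ (n + 2)))
           / ((l1 - l2) * (l1 - l3) * (l1 - l4) * (l2 - l3) * (l2 - l4) * (l3 - l4))))
   \<and> (\<forall>l1 l2 l3 :: complex.
        penta_poly a b c d e = [:- l1, 1:] ^ 2 * [:- l2, 1:] * [:- l3, 1:] \<longrightarrow>
        distinct [l1, l2, l3] \<longrightarrow>
        det (penta_toeplitz n a b c d e) =
          c ^ n *
          ((l1 ^ (1 + n) *
              (l1 ^ (3 + n) * (l2 - l3)
               + l2 ^ (2 + n) *
                   (l1 * (- (2 + of_nat n) * l1 + l2 + of_nat n * l2)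
                    + ((3 + of_nat n) * l1 - (2 + of_nat n) * l2) * l3))
            + l3 ^ (2 + n) *
              (l2 ^ (2 + n) * (l2 - l3)
               + l1 ^ (1 + n) *
                   ((2 + of_nat n) * l1 ^ 2 + (2 + of_nat n) * l2 * l3
                    - l1 * ((3 + of_nat n) * l2 + l3 + of_nat n * l3))))
           / ((l1 - l2) ^ 2 * (l1 - l3) ^ 2 * (l2 - l3))))
   \<and> (\<forall>l1 l2 :: complex.
        penta_poly a b c d e = [:- l1, 1:] ^ 2 * [:- l2, 1:] ^ 2 \<longrightarrow>
        l1 \<noteq> l2 \<longrightarrow>
        det (penta_toeplitz n a b c d e) =
          c ^ n *
          ((l1 ^ (4 + 2 * n)
            - (2 + of_nat n) ^ 2 * (l1 * l2) ^ (1 + n) * (l1 ^ 2 + l2 ^ 2)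
            + 2 * (3 + 4 * of_nat n + of_nat n ^ 2) * (l1 * l2) ^ (2 + n)
            + l2 ^ (4 + 2 * n))
           / (l1 - l2) ^ 4))
   \<and> (\<forall>l1 l2 :: complex.
        penta_poly a b c d e = [:- l1, 1:] ^ 3 * [:- l2, 1:] \<longrightarrow>
        l1 \<noteq> l2 \<longrightarrow>
        det (penta_toeplitz n a b c d e) =
          c ^ n *
          (((2 + of_nat n) * l1 ^ n *
              ((1 + of_nat n) * (l1 ^ (3 + n) - l2 ^ (3 + n))
               - (3 + of_nat n) * l1 ^ (2 + n) * l2
               + (3 + of_nat n) * l1 * l2 ^ (2 + n)))
           / (2 * (l1 - l2) ^ 3)))
   \<and> (\<forall>l1 :: complex.
        penta_poly a b c d e = [:- l1, 1:] ^ 4 \<longrightarrow>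
        det (penta_toeplitz n a b c d e) =
          c ^ n / 12 * (of_nat n + 3) * (of_nat n + 2) ^ 2 * (of_nat n + 1) * l1 ^ (2 * n))"
proof (intro conjI allI impI, goal_cases)
  case (1 l1 l2 l3 l4)
  from 1 have p: "penta_poly a b c d e = [:- l1, 1:] * [:- l2, 1:] * [:- l3, 1:] * [:- l4, 1:]"
    by (simp only: power2_eq_square power3_eq_cube power4_eq_xxxx mult.assoc)
  \<comment> \<open>This is the determinant with rows \<open>(1, l, l^2, l^k)\<close> for the four
    roots \<open>l\<close>, expanded along its last column. Two columns agree for
    \<open>k < 3\<close>, and \<open>k = 3\<close> gives the Vandermonde determinant.\<close>
  define v where "v = (\<lambda>k. l1 ^ k * ((l2 - l3) * (l2 - l4) * (l3 - l4)) - l2 ^ k * ((l1 - l3) * (l1 - l4) * (l3 - l4))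
    + l3 ^ k * ((l1 - l2) * (l1 - l4) * (l2 - l4)) - l4 ^ k * ((l1 - l2) * (l1 - l3) * (l2 - l3)))"
  have v3: "v 3 = (l1 - l2) * (l1 - l3) * (l1 - l4) * (l2 - l3) * (l2 - l4) * (l3 - l4)"
    unfolding v_def of_nat_numeral by Groebner_Basis.algebra
  show ?case
  proof (rule det_penta_toeplitz_of_roots[OF p \<open>c \<noteq> 0\<close>, of v])
    show "v 0 = 0" "v 1 = 0" "v 2 = 0"
      unfolding v_def by (simp_all add: algebra_simps power2_eq_square)
    show "v 3 \<noteq> 0"
      unfolding v3 using 1(2)[simplified] by simp
    fix k
    show "v (k + 4) - (l1 + l2 + l3 + l4) * v (k + 3)
      + (l1 * l2 + l1 * l3 + l1 * l4 + l2 * l3 + l2 * l4 + l3 * l4) * v (k + 2)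
      - (l1 * l2 * l3 + l1 * l2 * l4 + l1 * l3 * l4 + l2 * l3 * l4) * v (k + 1)
      + l1 * l2 * l3 * l4 * v k = 0"
      unfolding v_def power_add of_nat_add of_nat_numeral of_nat_1 by Groebner_Basis.algebra
  \<comment> \<open>The first call of \<open>simp\<close> settles that the denominator is nonzero.
    Once the powers are split, each \<open>l ^ n\<close> (and in the later cases also
    \<open>n\<close> itself) can be treated as an indeterminate, so the identity is purely
    polynomial.\<close>
  qed (simp add: 1(2)[simplified], unfold v3,
      unfold v_def power_add of_nat_add of_nat_numeral of_nat_1 mult_2[of n] power_mult_distrib,
      Groebner_Basis.algebra)
next
  case (2 l1 l2 l3)
  from 2 have p: "penta_poly a b c d e = [:- l1, 1:] * [:- l1, 1:] * [:- l2, 1:] * [:- l3, 1:]"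
    by (simp only: power2_eq_square power3_eq_cube power4_eq_xxxx mult.assoc)
  have nz: "l1 \<noteq> 0" "l2 \<noteq> 0" "l3 \<noteq> 0"
    using penta_poly_eq_prodD(1)[OF p] assms by auto
  \<comment> \<open>The sum of the residues of \<open>x^k / p(x)\<close> is 0 for
    \<open>k < 3\<close> and 1 for \<open>k = 3\<close>. Here it is multiplied by the denominator of
    the claim and by \<open>l1\<close>, which absorbs the exponent \<open>k - 1\<close> from the
    derivative at the double root. Hence \<open>v 3\<close> is the scaling factor, nonzero because
    \<open>l1\<close> is.\<close>
  define v where "v = (\<lambda>k. of_nat k * l1 ^ k * (l1 - l2) * (l1 - l3) * (l2 - l3)
    - l1 * (l1 ^ k * (2 * l1 - l2 - l3) * (l2 - l3) - l2 ^ k * (l1 - l3) ^ 2 + l3 ^ k * (l1 - l2) ^ 2))"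
  have v3: "v 3 = l1 * ((l1 - l2) ^ 2 * (l1 - l3) ^ 2 * (l2 - l3))"
    unfolding v_def of_nat_numeral by Groebner_Basis.algebra
  show ?case
  proof (rule det_penta_toeplitz_of_roots[OF p \<open>c \<noteq> 0\<close>, of v])
    show "v 0 = 0" "v 1 = 0" "v 2 = 0"
      unfolding v_def by (simp_all add: algebra_simps power2_eq_square)
    show "v 3 \<noteq> 0"
      unfolding v3 using nz 2(2)[simplified] by simp
    fix k
    show "v (k + 4) - (l1 + l1 + l2 + l3) * v (k + 3)
      + (l1 * l1 + l1 * l2 + l1 * l3 + l1 * l2 + l1 * l3 + l2 * l3) * v (k + 2)
      - (l1 * l1 * l2 + l1 * l1 * l3 + l1 * l2 * l3 + l1 * l2 * l3) * v (k + 1)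
      + l1 * l1 * l2 * l3 * v k = 0"
      unfolding v_def power_add of_nat_add of_nat_numeral of_nat_1 by Groebner_Basis.algebra
  qed (simp add: nz 2(2)[simplified], unfold v3,
      unfold v_def power_add of_nat_add of_nat_numeral of_nat_1 mult_2[of n] power_mult_distrib,
      Groebner_Basis.algebra)
next
  case (3 l1 l2)
  from 3 have p: "penta_poly a b c d e = [:- l1, 1:] * [:- l1, 1:] * [:- l2, 1:] * [:- l2, 1:]"
    by (simp only: power2_eq_square power3_eq_cube power4_eq_xxxx mult.assoc)
  have nz: "l1 \<noteq> 0" "l2 \<noteq> 0"
    using penta_poly_eq_prodD(1)[OF p] assms by auto
  \<comment> \<open>The same residue sum, scaled by \<open>l1 * l2 * (l1 - l2) ^ 3\<close>: both
    double roots contribute a derivative.\<close>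
  define v where "v = (\<lambda>k. of_nat k * (l1 - l2) * (l2 * l1 ^ k + l1 * l2 ^ k) - 2 * l1 * l2 * (l1 ^ k - l2 ^ k))"
  have v3: "v 3 = l1 * l2 * (l1 - l2) ^ 3"
    unfolding v_def of_nat_numeral by Groebner_Basis.algebra
  show ?case
  proof (rule det_penta_toeplitz_of_roots[OF p \<open>c \<noteq> 0\<close>, of v])
    show "v 0 = 0" "v 1 = 0" "v 2 = 0"
      unfolding v_def by (simp_all add: algebra_simps power2_eq_square)
    show "v 3 \<noteq> 0"
      unfolding v3 using nz 3(2) by simp
    fix k
    show "v (k + 4) - (l1 + l1 + l2 + l2) * v (k + 3)
      + (l1 * l1 + l1 * l2 + l1 * l2 + l1 * l2 + l1 * l2 + l2 * l2) * v (k + 2)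
      - (l1 * l1 * l2 + l1 * l1 * l2 + l1 * l2 * l2 + l1 * l2 * l2) * v (k + 1)
      + l1 * l1 * l2 * l2 * v k = 0"
      unfolding v_def power_add of_nat_add of_nat_numeral of_nat_1 by Groebner_Basis.algebra
  qed (simp add: nz 3(2), unfold v3,
      unfold v_def power_add of_nat_add of_nat_numeral of_nat_1 mult_2[of n] power_mult_distrib,
      Groebner_Basis.algebra)
next
  case (4 l1 l2)
  from 4 have p: "penta_poly a b c d e = [:- l1, 1:] * [:- l1, 1:] * [:- l1, 1:] * [:- l2, 1:]"
    by (simp only: power2_eq_square power3_eq_cube power4_eq_xxxx mult.assoc)
  have nz: "l1 \<noteq> 0" "l2 \<noteq> 0"
    using penta_poly_eq_prodD(1)[OF p] assms by auto
  \<comment> \<open>The residue at the triple root is half a second derivative, which explains the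
    factor \<open>2 * l1 ^ 2\<close> in the scaling.\<close>
  define v where "v = (\<lambda>k. of_nat k * (of_nat k - 1) * l1 ^ k * (l1 - l2) ^ 2 - 2 * of_nat k * l1 * l1 ^ k * (l1 - l2)
    + 2 * l1 ^ 2 * (l1 ^ k - l2 ^ k))"
  have v3: "v 3 = l1 ^ 2 * (2 * (l1 - l2) ^ 3)"
    unfolding v_def of_nat_numeral by Groebner_Basis.algebra
  show ?case
  proof (rule det_penta_toeplitz_of_roots[OF p \<open>c \<noteq> 0\<close>, of v])
    show "v 0 = 0" "v 1 = 0" "v 2 = 0"
      unfolding v_def by (simp_all add: algebra_simps power2_eq_square)
    show "v 3 \<noteq> 0"
      unfolding v3 using nz 4(2) by simp
    fix k
    show "v (k + 4) - (l1 + l1 + l1 + l2) * v (k + 3)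
      + (l1 * l1 + l1 * l1 + l1 * l2 + l1 * l1 + l1 * l2 + l1 * l2) * v (k + 2)
      - (l1 * l1 * l1 + l1 * l1 * l2 + l1 * l1 * l2 + l1 * l1 * l2) * v (k + 1)
      + l1 * l1 * l1 * l2 * v k = 0"
      unfolding v_def power_add of_nat_add of_nat_numeral of_nat_1 by Groebner_Basis.algebra
  qed (simp add: nz 4(2), unfold v3,
      unfold v_def power_add of_nat_add of_nat_numeral of_nat_1 mult_2[of n] power_mult_distrib,
      Groebner_Basis.algebra)
next
  case (5 l1)
  from 5 have p: "penta_poly a b c d e = [:- l1, 1:] * [:- l1, 1:] * [:- l1, 1:] * [:- l1, 1:]"
    by (simp only: power2_eq_square power3_eq_cube power4_eq_xxxx mult.assoc)
  have nz: "l1 \<noteq> 0"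
    using penta_poly_eq_prodD(1)[OF p] assms by auto
  \<comment> \<open>A single residue, a third derivative divided by 6, scaled by
    \<open>6 * l1 ^ 3\<close>.\<close>
  define v where "v = (\<lambda>k. of_nat k * (of_nat k - 1) * (of_nat k - 2) * l1 ^ k)"
  have v3: "v 3 = 6 * l1 ^ 3"
    unfolding v_def of_nat_numeral by Groebner_Basis.algebra
  \<comment> \<open>Regrouped so that 12 takes the place of the denominator
    \<open>D\<close>.\<close>
  have "det (penta_toeplitz n a b c d e) = c ^ n * ((of_nat n + 3) * (of_nat n + 2) ^ 2 * (of_nat n + 1) * l1 ^ (2 * n) / 12)"
  proof (rule det_penta_toeplitz_of_roots[OF p \<open>c \<noteq> 0\<close>, of v])
    show "v 0 = 0" "v 1 = 0" "v 2 = 0"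
      unfolding v_def by (simp_all add: algebra_simps power2_eq_square)
    show "v 3 \<noteq> 0"
      unfolding v3 using nz by simp
    fix k
    show "v (k + 4) - (l1 + l1 + l1 + l1) * v (k + 3)
      + (l1 * l1 + l1 * l1 + l1 * l1 + l1 * l1 + l1 * l1 + l1 * l1) * v (k + 2)
      - (l1 * l1 * l1 + l1 * l1 * l1 + l1 * l1 * l1 + l1 * l1 * l1) * v (k + 1)
      + l1 * l1 * l1 * l1 * v k = 0"
      unfolding v_def power_add of_nat_add of_nat_numeral of_nat_1 by Groebner_Basis.algebra
  qed (simp add: nz, unfold v3,
      unfold v_def power_add of_nat_add of_nat_numeral of_nat_1 mult_2[of n] power_mult_distrib,
      Groebner_Basis.algebra)
  then show ?case by simp
qed

end
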